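(* Let $c\ge1$ be an absolute constant such that for all integers $k\ge1$, \[\sum_{i=1}^{k-1}\left(\frac ki\right)^{i/2}\left(\frac k{k-i}\right)^{(k-i)/2}\frac{1}{\sqrt{i(k-i)}}\le c\sqrt{\frac{2^k}{k}}.\] Let $N\colon\{1,2,4,8,16,\dots\}\times\mathbb Z^+\to[0,\infty)$ be any function satisfying $N(n,k)\le\binom nk^{1/2}$ whenever $\min\{n,k\}\le2$, and \[N(n,k)\le 2N\!\left(\tfrac n2,k\right)+\sum_{i=1}^{k-1}N\!\left(\tfrac n2,i\right)N\!\left(\tfrac n2,k-i\right)\] whenever $\min\{n,k\}>2$. Then for all $n,k$ in the domain, \[N(n,k)\le\frac{(2+\sqrt2)^{k-1}c^{k-1}}{\sqrt k}\left(\frac nk\right)^{k/2}.\] *)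

theory Defs
  imports Complex_Main
begin

definition powers_of_two :: "nat set" where
  "powers_of_two = range (\<lambda>m. 2 ^ m)"

end

theory Submission
  imports Defs
begin

text \<open>
  Put \<open>A = (2 + sqrt 2) c\<close> and let \<open>F(n, k)\<close> be the claimed bound. Halving \<open>n\<close> divides
  \<open>F(n, k)\<close> by \<open>2 powr (k / 2)\<close>, and the hypothesis on \<open>c\<close> says exactly that the convolution of
  \<open>F(n / 2, _)\<close> with itself is at most \<open>c / A = 1 / (2 + sqrt 2)\<close> times \<open>F(n, k)\<close>. So induction
  on \<open>n\<close> closes because \<open>2 / 2 powr (3 / 2) + 1 / (2 + sqrt 2) = 1\<close>.
\<close>

text \<open>The argument \<open>x\<close> is real so that halving is exact division.
  \<open>A\<close> stands for \<open>(2 + sqrt 2) * c\<close>, kept abstract because the lemmas use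
  only its sign or a lower bound.\<close>

definition target_bound :: "real \<Rightarrow> real \<Rightarrow> nat \<Rightarrow> real" where
  "target_bound A x k = A ^ (k - 1) / sqrt (real k) * (x / real k) powr (real k / 2)"

lemma target_bound_nonneg: "A \<ge> 0 \<Longrightarrow> target_bound A x k \<ge> 0"
  by (simp add: target_bound_def)

lemma target_bound_half:
  assumes "x > 0"
  shows "target_bound A (x / 2) k = target_bound A x k / 2 powr (real k / 2)"
proof -
  have "(x / 2 / real k) powr (real k / 2) = (x / real k / 2) powr (real k / 2)"
    by (simp add: mult.commute)
  also have "\<dots> = (x / real k) powr (real k / 2) / 2 powr (real k / 2)"
    by (rule powr_divide)
  finally show ?thesis
    by (simp add: target_bound_def)
qed

text \<open>The exponents \<open>i / 2\<close> and \<open>(k - i) / 2\<close> add up to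
  \<open>k / 2\<close>, and those of \<open>A\<close> to \<open>k - 2\<close>, so all dependence on
  \<open>x\<close> and \<open>A\<close> leaves the sum over \<open>i\<close>. What remains is the
  summand in the hypothesis on \<open>c\<close>.\<close>

lemma target_bound_mult:
  assumes "x > 0" "1 \<le> i" "i < k"
  shows "target_bound A x i * target_bound A x (k - i) =
    A ^ (k - 2) * (x / real k) powr (real k / 2) *
    ((real k / real i) powr (real i / 2) * (real k / real (k - i)) powr (real (k - i) / 2)
      * (1 / sqrt (real i * real (k - i))))"
proof -
  have split: "(x / real j) powr (real j / 2) =
      (x / real k) powr (real j / 2) * (real k / real j) powr (real j / 2)" if "j \<ge> 1" for j
  proof -
    have "x / real j = x / real k * (real k / real j)"
      using assms by simp
    then show ?thesis
      using assms by (simp only: powr_mult divide_nonneg_nonneg of_nat_0_le_iff less_imp_le)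
  qed
  have "real k / 2 = real i / 2 + real (k - i) / 2"
    using assms by (simp add: field_simps)
  then have powk: "(x / real k) powr (real k / 2) =
      (x / real k) powr (real i / 2) * (x / real k) powr (real (k - i) / 2)"
    by (simp only: powr_add)
  have "i - 1 + (k - i - 1) = k - 2"
    using assms by simp
  then have powA: "A ^ (k - 2) = A ^ (i - 1) * A ^ (k - i - 1)"
    by (metis power_add)
  have "k - i \<ge> 1"
    using assms by simp
  show ?thesis
    unfolding target_bound_def split[OF \<open>1 \<le> i\<close>] split[OF \<open>k - i \<ge> 1\<close>] powk powA real_sqrt_mult
    by (simp add: mult_ac)
qed

lemma sqrt_power_eq_powr: "sqrt (2 ^ k) = 2 powr (real k / 2)"
  by (simp add: powr_half_sqrt[symmetric] powr_powr powr_realpow[symmetric])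

text \<open>In \<open>sqrt (2 ^ k / k)\<close> the numerator undoes the loss from halving
  \<open>x\<close> and the denominator restores the factor \<open>1 / sqrt k\<close>. The product
  carries one power of \<open>A\<close> less than the target, whence \<open>c / A\<close>.\<close>

lemma sum_target_bound_mult_le:
  assumes "x > 0" "A > 0" "k \<ge> 2"
    and c: "(\<Sum>i=1..k-1. (real k / real i) powr (real i / 2)
          * (real k / real (k - i)) powr (real (k - i) / 2)
          * (1 / sqrt (real i * real (k - i)))) \<le> c * sqrt (2 ^ k / real k)"
  shows "(\<Sum>i=1..k-1. target_bound A (x / 2) i * target_bound A (x / 2) (k - i))
    \<le> c / A * target_bound A x k"
proof -
  define D where "D = A ^ (k - 2) * (x / 2 / real k) powr (real k / 2)"
  have D: "D \<ge> 0"
    using assms by (simp add: D_def)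
  have "(\<Sum>i=1..k-1. target_bound A (x / 2) i * target_bound A (x / 2) (k - i)) =
      D * (\<Sum>i=1..k-1. (real k / real i) powr (real i / 2)
          * (real k / real (k - i)) powr (real (k - i) / 2)
          * (1 / sqrt (real i * real (k - i))))"
    unfolding sum_distrib_left D_def
    using assms by (intro sum.cong refl target_bound_mult) auto
  also have "\<dots> \<le> D * (c * sqrt (2 ^ k / real k))"
    using c D by (rule mult_left_mono)
  also have "\<dots> = c / A * (target_bound A (x / 2) k * 2 powr (real k / 2))"
  proof -
    have "k - 1 = Suc (k - 2)"
      using \<open>k \<ge> 2\<close> by simp
    then have "A ^ (k - 1) = A * A ^ (k - 2)"
      by simp
    then show ?thesis
      using assms unfolding D_def target_bound_def real_sqrt_divide sqrt_power_eq_powr by simp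
  qed
  also have "\<dots> = c / A * target_bound A x k"
    using assms by (simp add: target_bound_half)
  finally show ?thesis .
qed

lemma sqrt_binomial_le_target_bound:
  assumes "A \<ge> 2" "n \<ge> 1" "k \<ge> 1" "min n k \<le> 2"
  shows "sqrt (real (n choose k)) \<le> target_bound A (real n) k"
proof -
  \<comment> \<open>If \<open>k \<le> n\<close>, the minimum is \<open>k\<close>, so only
    \<open>k = 1\<close> and \<open>k = 2\<close> remain.\<close>
  consider "n < k" | "k = 1" | "k = 2" "k \<le> n"
    using assms by linarith
  then show ?thesis
  proof cases
    case 1
    then show ?thesis
      using assms by (simp add: binomial_eq_0 target_bound_nonneg)
  next
    case 2
    then show ?thesis
      by (simp add: target_bound_def powr_half_sqrt)
  next
    case 3
    \<comment> \<open>Parity makes the \<open>div 2\<close> in \<open>choose_two\<close>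
      exact.\<close>
    have "even (n * (n - 1))"
      by (cases n) auto
    then have "2 * (n choose 2) = n * (n - 1)"
      by (simp only: choose_two dvd_mult_div_cancel)
    then have "2 * real (n choose 2) = real n * real (n - 1)"
      by (metis of_nat_mult of_nat_numeral)
    also have "\<dots> \<le> real n * real n"
      by (intro mult_left_mono) auto
    finally have "real (n choose 2) \<le> (real n)\<^sup>2 / 2"
      by (simp add: power2_eq_square)
    then have "sqrt (real (n choose 2)) \<le> sqrt ((real n)\<^sup>2 / 2)"
      by simp
    also have "\<dots> = real n / sqrt 2"
      by (simp add: real_sqrt_divide)
    also have "\<dots> = 2 * (real n / 2) / sqrt 2"
      by simp
    \<comment> \<open>This is where \<open>A \<ge> 2\<close> is needed: the bound at
      \<open>k = 2\<close> is \<open>A / 2\<close> times \<open>n / sqrt 2\<close>.\<close>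
    also have "\<dots> \<le> A * (real n / 2) / sqrt 2"
      using \<open>A \<ge> 2\<close> by (intro divide_right_mono mult_right_mono) auto
    also have "\<dots> = target_bound A (real n) 2"
      using assms by (simp add: target_bound_def)
    finally show ?thesis
      using 3 by simp
  qed
qed

text \<open>The left side decreases in \<open>k\<close>, and at \<open>k = 3\<close> it is
  \<open>sqrt 2 / 2 + (1 - sqrt 2 / 2) = 1\<close>. The constant \<open>2 + sqrt 2\<close> is chosen
  to give equality there.\<close>

lemma halving_factor_le_1:
  assumes "k \<ge> 3"
  shows "2 / 2 powr (real k / 2) + 1 / (2 + sqrt 2) \<le> 1"
proof -
  have "2 * sqrt 2 = 2 powr (3 / 2)"
    using powr_add[of "2::real" 1 "1 / 2"] by (simp add: powr_half_sqrt)
  also have "\<dots> \<le> 2 powr (real k / 2)"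
    using assms by (intro powr_mono) auto
  finally have "2 * sqrt 2 \<le> 2 powr (real k / 2)" .
  then have "2 / 2 powr (real k / 2) \<le> 2 / (2 * sqrt 2)"
    by (intro divide_left_mono) auto
  also have "\<dots> = sqrt 2 / 2"
    by (simp add: field_simps)
  finally have "2 / 2 powr (real k / 2) \<le> sqrt 2 / 2" .
  moreover have "1 / (2 + sqrt 2) = 1 - sqrt 2 / 2"
  proof -
    have "2 + sqrt 2 > 0"
      by (simp add: add_pos_pos)
    moreover have "(1 - sqrt 2 / 2) * (2 + sqrt 2) = 1"
      by (simp add: algebra_simps)
    ultimately show ?thesis
      by (metis nonzero_eq_divide_eq less_irrefl)
  qed
  ultimately show ?thesis
    by linarith
qed

theorem theorem3p2:
  fixes c :: real and N :: "nat \<Rightarrow> nat \<Rightarrow> real"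
  assumes c_ge_1: "c \<ge> 1"
    and c_bound: "\<And>k::nat. k \<ge> 1 \<Longrightarrow>
      (\<Sum>i=1..k-1. (real k / real i) powr (real i / 2)
          * (real k / real (k - i)) powr (real (k - i) / 2)
          * (1 / sqrt (real i * real (k - i))))
        \<le> c * sqrt (2 ^ k / real k)"
    and N_nonneg: "\<And>n k. n \<in> powers_of_two \<Longrightarrow> k \<ge> 1 \<Longrightarrow> N n k \<ge> 0"
    and N_base: "\<And>n k. n \<in> powers_of_two \<Longrightarrow> k \<ge> 1 \<Longrightarrow> min n k \<le> 2 \<Longrightarrow>
      N n k \<le> sqrt (real (n choose k))"
    and N_rec: "\<And>n k. n \<in> powers_of_two \<Longrightarrow> k \<ge> 1 \<Longrightarrow> min n k > 2 \<Longrightarrow>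
      N n k \<le> 2 * N (n div 2) k + (\<Sum>i=1..k-1. N (n div 2) i * N (n div 2) (k - i))"
  shows "\<forall>n\<in>powers_of_two. \<forall>k\<ge>1.
      N n k \<le> (2 + sqrt 2) ^ (k - 1) * c ^ (k - 1) / sqrt (real k)
        * (real n / real k) powr (real k / 2)"
proof -
  define A where "A = (2 + sqrt 2) * c"
  have c_pos: "c > 0"
    using c_ge_1 by simp
  have "2 * 1 \<le> (2 + sqrt 2) * c"
    using c_ge_1 by (intro mult_mono) auto
  then have A: "A \<ge> 2"
    by (simp add: A_def)
  have cA: "c / A = 1 / (2 + sqrt 2)"
    using c_pos by (simp add: A_def)
  \<comment> \<open>\<open>k\<close> stays arbitrary because the recursion calls \<open>N\<close> at
    \<open>n / 2\<close> for every index from \<open>1\<close> to \<open>k\<close>.\<close>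
  have "N (2 ^ m) k \<le> target_bound A (2 ^ m) k" if "k \<ge> 1" for m k
    using that
  proof (induction m arbitrary: k)
    case 0
    \<comment> \<open>For \<open>n = 1\<close> the minimum is at most \<open>2\<close> whatever
      \<open>k\<close> is.\<close>
    have "N 1 k \<le> sqrt (real (1 choose k))"
      using 0 by (intro N_base) (auto simp: powers_of_two_def intro: range_eqI[of _ _ 0])
    also have "\<dots> \<le> target_bound A (real 1) k"
      using A 0 by (intro sqrt_binomial_le_target_bound) auto
    finally show ?case
      by simp
  next
    case (Suc m)
    let ?n = "2 ^ Suc m :: nat" and ?h = "2 ^ m :: nat" and ?x = "2 ^ Suc m :: real"
    have pow: "?n \<in> powers_of_two" "?h \<in> powers_of_two"
      unfolding powers_of_two_def by blast+
    have IH: "N ?h i \<le> target_bound A (?x / 2) i" if "i \<ge> 1" for i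
      using Suc.IH[OF that] by simp
    show ?case
    proof (cases "min ?n k \<le> 2")
      case True
      then have "N ?n k \<le> sqrt (real (?n choose k))"
        using pow Suc.prems by (intro N_base)
      also have "\<dots> \<le> target_bound A (real ?n) k"
        using A Suc.prems True by (intro sqrt_binomial_le_target_bound) auto
      finally show ?thesis
        by simp
    next
      case False
      then have k: "k \<ge> 3"
        by simp
      have half: "?n div 2 = ?h"
        by simp
      from False have "min ?n k > 2"
        by linarith
      then have "N ?n k \<le> 2 * N ?h k + (\<Sum>i=1..k-1. N ?h i * N ?h (k - i))"
        using N_rec[of ?n k] pow Suc.prems unfolding half by blast
      also have "\<dots> \<le> 2 * target_bound A (?x / 2) k +
          (\<Sum>i=1..k-1. target_bound A (?x / 2) i * target_bound A (?x / 2) (k - i))"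
      proof (intro add_mono mult_left_mono sum_mono)
        fix i assume "i \<in> {1..k-1}"
        then have i: "i \<ge> 1" "k - i \<ge> 1"
          using k by auto
        \<comment> \<open>Multiplying the two induction hypotheses requires nonnegativity of one
          \<open>N\<close> factor and of one bound.\<close>
        show "N ?h i * N ?h (k - i) \<le> target_bound A (?x / 2) i * target_bound A (?x / 2) (k - i)"
          using A i by (intro mult_mono IH target_bound_nonneg N_nonneg pow) auto
      qed (use IH Suc.prems in auto)
      also have "\<dots> \<le> 2 * (target_bound A ?x k / 2 powr (real k / 2)) +
          c / A * target_bound A ?x k"
        using A k Suc.prems target_bound_half[of ?x A k]
        by (intro add_mono sum_target_bound_mult_le c_bound) auto
      also have "\<dots> = (2 / 2 powr (real k / 2) + 1 / (2 + sqrt 2)) * target_bound A ?x k"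
        unfolding cA by (simp add: distrib_right)
      also have "\<dots> \<le> 1 * target_bound A ?x k"
        using A k by (intro mult_right_mono halving_factor_le_1 target_bound_nonneg) auto
      finally show ?thesis
        by simp
    qed
  qed
  \<comment> \<open>\<open>A ^ (k - 1)\<close> splits into the two powers of the claim.\<close>
  then show ?thesis
    by (auto simp: powers_of_two_def target_bound_def A_def power_mult_distrib)
qed

end
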